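(* Let $\omega\in\mathbb{R}^m$ and let $U_j:(\mathbb{R}/2\pi\mathbb{Z})^m\to\mathbb{R}^m$ be a smooth function. For any (finite) $K\in\mathbb{N}$, a smooth function ${\bf g}_j:(\mathbb{R}/2\pi\mathbb{Z})^m\to\mathbb{R}^m$ can be chosen in such a way that the solution ${\bf f}_j:(\mathbb{R}/2\pi\mathbb{Z})^m\to\mathbb{R}^m$ to the tangential homological equation $$\partial_\omega{\bf g}_j+{\bf f}_j=U_j$$ is in normal form to order $K$ in its Fourier expansion.
   Context: Smooth means $C^\infty$. $\partial_\omega{\bf A}:={\bf A}'\cdot\omega$ is the directional derivative in the direction $\omega$. Write the Fourier series ${\bf f}_j(\phi)=\sum_{k\in\mathbb{Z}^m}f_{j,k}e^{i\langle k,\phi\rangle}$, $f_{j,k}\in\mathbb{C}^m$, with $\langle k,\phi\rangle=k_1\phi_1+\ldots+k_m\phi_m$, and $|k|=(|k_1|^2+\ldots+|k_m|^2)^{1/2}$. ${\bf f}_j$ is in normal form to order $K$ in its Fourier expansion if $f_{j,k}=0$ for all $k\in\mathbb{Z}^m$ with $\langle\omega,k\rangle\neq0$ and $|k|\le K$. No nonresonance condition on $\omega$ is assumed. *)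

theory Defs
  imports "HOL-Analysis.Analysis"
begin

text \<open>
  Functions on the torus are rendered as functions on \<open>real ^ 'm\<close> that are
  \<open>2 * pi\<close>-periodic in every coordinate.
\<close>

definition int_vec :: "int ^ 'm \<Rightarrow> real ^ 'm" where
  "int_vec k = (\<chi> i. real_of_int (k $ i))"

definition torus_fun :: "(real ^ 'm \<Rightarrow> 'b) \<Rightarrow> bool" where
  "torus_fun f \<longleftrightarrow> (\<forall>x k. f (x + (2 * pi) *\<^sub>R int_vec k) = f x)"

text \<open>
  \<open>C_diff n f\<close> says that \<open>f\<close> is of class \<open>C\<^sup>n\<close>: it is Frechet differentiable everywhere
  and all its directional derivatives are of class \<open>C\<^sup>n\<^sup>-\<^sup>1\<close>.
\<close>

primrec C_diff :: "nat \<Rightarrow> ('a::euclidean_space \<Rightarrow> 'b::real_normed_vector) \<Rightarrow> bool" where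
  "C_diff 0 f \<longleftrightarrow> continuous_on UNIV f"
| "C_diff (Suc n) f \<longleftrightarrow>
     (\<forall>x. f differentiable (at x)) \<and> (\<forall>v. C_diff n (\<lambda>x. frechet_derivative f (at x) v))"

definition smooth :: "('a::euclidean_space \<Rightarrow> 'b::real_normed_vector) \<Rightarrow> bool" where
  "smooth f \<longleftrightarrow> (\<forall>n. C_diff n f)"

definition dir_deriv :: "'a::real_normed_vector \<Rightarrow> ('a \<Rightarrow> 'b::real_normed_vector) \<Rightarrow> 'a \<Rightarrow> 'b" where
  "dir_deriv \<omega> A x = frechet_derivative A (at x) \<omega>"

text \<open>
  The coefficient \<open>f\<^sub>k \<in> \<complex>\<^sup>m\<close> of \<open>e\<^sup>i\<^sup>\<langle>\<^sup>k\<^sup>,\<^sup>x\<^sup>\<rangle>\<close>, that is,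
  the average of \<open>f x * exp (- \<i> \<langle>k, x\<rangle>)\<close> over the torus.
\<close>

definition fourier_coeff :: "(real ^ 'm \<Rightarrow> real ^ 'm) \<Rightarrow> int ^ 'm \<Rightarrow> complex ^ 'm" where
  "fourier_coeff f k =
     (1 / (2 * pi) ^ CARD('m)) *\<^sub>R
       integral (cbox 0 (\<chi> i. 2 * pi))
         (\<lambda>x. \<chi> i. complex_of_real (f x $ i) * exp (- \<i> * complex_of_real (int_vec k \<bullet> x)))"

definition normal_form_to_order :: "real ^ 'm \<Rightarrow> nat \<Rightarrow> (real ^ 'm \<Rightarrow> real ^ 'm) \<Rightarrow> bool" where
  "normal_form_to_order \<omega> K f \<longleftrightarrow>
     (\<forall>k. \<omega> \<bullet> int_vec k \<noteq> 0 \<and> norm (int_vec k) \<le> real K \<longrightarrow> fourier_coeff f k = 0)"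

end

theory Submission
  imports Defs
begin

text \<open>
  Only finitely many frequencies \<open>k\<close> have to be removed from \<open>U\<close>, so no small divisor estimate is
  needed: \<open>g\<close> is the trigonometric polynomial with coefficients \<open>U\<^sub>k / (\<i> \<langle>\<omega>, k\<rangle>)\<close> for
  \<open>\<langle>\<omega>, k\<rangle> \<noteq> 0\<close> and \<open>|k| \<le> K\<close>. Then \<open>\<partial>\<^sub>\<omega>g\<close> is the part of the Fourier series of \<open>U\<close> at these
  frequencies, which is real because the set of frequencies is symmetric and \<open>U\<^sub>-\<^sub>k\<close> is the
  conjugate of \<open>U\<^sub>k\<close>.
\<close>

lemma inner_int_vec: "int_vec k \<bullet> int_vec l = real_of_int (\<Sum>i\<in>UNIV. k $ i * l $ i)"
  by (simp add: int_vec_def inner_vec_def)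

lemma int_vec_uminus: "int_vec (- k) = - int_vec k"
  by (simp add: int_vec_def vec_eq_iff)

lemma int_vec_diff: "int_vec (k - l) = int_vec k - int_vec l"
  by (simp add: int_vec_def vec_eq_iff)

text \<open>Each coordinate is bounded by the norm, so the vectors lie in a finite integer box. This
  is what makes the set of frequencies to be removed finite.\<close>

lemma finite_int_vec_ball: "finite {k :: int ^ 'm. norm (int_vec k) \<le> r}"
proof (rule finite_subset)
  let ?A = "{- \<lceil>r\<rceil>..\<lceil>r\<rceil>}"
  show "{k :: int ^ 'm. norm (int_vec k) \<le> r} \<subseteq> vec_lambda ` (PiE UNIV (\<lambda>_. ?A))"
  proof clarify
    fix k :: "int ^ 'm" assume k: "norm (int_vec k) \<le> r"
    have "k $ i \<in> ?A" for i
    proof -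
      have "\<bar>real_of_int (k $ i)\<bar> \<le> r"
        using component_le_norm_cart[of "int_vec k" i] k by (simp add: int_vec_def)
      then show ?thesis by simp linarith
    qed
    then have "vec_nth k \<in> PiE UNIV (\<lambda>_. ?A)" by auto
    then show "k \<in> vec_lambda ` (PiE UNIV (\<lambda>_. ?A))"
      by (intro image_eqI[where x = "vec_nth k"]) auto
  qed
qed (intro finite_imageI finite_PiE; simp)

text \<open>For n nonzero the antiderivative takes the same value at both ends of the period. The
  indicator form lets this integral serve as one factor of a product integral over the whole
  space.\<close>

lemma integral_exp_period:
  "(LINT t|lborel. indicator {0..2 * pi} t *\<^sub>R exp (\<i> * complex_of_real (of_int n * t)))
     = (if n = 0 then 2 * pi else 0)"
proof (cases "n = 0")
  case False
  let ?F = "\<lambda>z. exp (\<i> * of_int n * z) / (\<i> * of_int n)"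
  have "((\<lambda>t. ?F (complex_of_real t)) has_vector_derivative exp (\<i> * complex_of_real (of_int n * t)))
          (at t within {0..2 * pi})" for t
    by (rule has_vector_derivative_real_field)
       (use False in \<open>auto intro!: derivative_eq_intros simp: mult_ac\<close>)
  then have "(LINT t|lborel. indicator {0..2 * pi} t *\<^sub>R exp (\<i> * complex_of_real (of_int n * t)))
      = ?F (complex_of_real (2 * pi)) - ?F (complex_of_real 0)"
    by (intro integral_FTC_Icc) (auto intro!: continuous_intros)
  also have "exp (\<i> * of_int n * complex_of_real (2 * pi)) = 1"
    using exp_integer_2pi[of "of_int n"] by (simp add: mult_ac)
  finally show ?thesis using False by simp
qed (simp add: scaleR_conv_of_real)

text \<open>Orthogonality of characters: the exponential factors over the coordinates, so Fubini
  reduces the integral to one-dimensional ones, and a nonzero coordinate of \<open>k\<close> makes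
  its factor vanish.\<close>

lemma integral_exp_int_vec:
  "integral (cbox 0 (\<chi> i. 2 * pi)) (\<lambda>x. exp (\<i> * complex_of_real (int_vec k \<bullet> x)))
     = (if k = 0 then (2 * pi) ^ CARD('m) else 0)" for k :: "int ^ 'm"
proof -
  let ?B = "Basis :: (real ^ 'm) set"
  let ?Q = "cbox 0 (\<chi> i. 2 * pi) :: (real ^ 'm) set"
  let ?e = "\<lambda>x. exp (\<i> * complex_of_real (int_vec k \<bullet> x))"
  \<comment> \<open>The factor in the basis direction \<open>b\<close>, with the indicator of the
    period built in, so that the cube needs no separate treatment.\<close>
  define h where "h b t = indicator {0..2 * pi} t *\<^sub>R exp (\<i> * complex_of_real ((int_vec k \<bullet> b) * t))"
    for b :: "real ^ 'm" and t :: real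
  interpret product_sigma_finite "\<lambda>_ :: real ^ 'm. lborel :: real measure"
    by standard
  have int_comp: "\<exists>n::int. int_vec k \<bullet> b = of_int n" if "b \<in> ?B" for b
    using that by (auto simp: Basis_vec_def inner_axis int_vec_def)
  have Q: "x \<in> ?Q \<longleftrightarrow> (\<forall>b\<in>?B. x \<bullet> b \<in> {0..2 * pi})" for x
    by (auto simp: mem_box Basis_vec_def inner_axis)
  have h_int: "integral\<^sup>L lborel (h b) = (if int_vec k \<bullet> b = 0 then 2 * pi else 0)"
    if "b \<in> ?B" for b
    using int_comp[OF that] integral_exp_period unfolding h_def
    by (auto simp: scaleR_conv_of_real)
  have h_integrable: "integrable lborel (h b)" for b
    unfolding h_def
    by (rule borel_integrable_compact) (auto intro!: continuous_intros)
  \<comment> \<open>On the cube this is the exponential of a sum; off the cube some factor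
    \<open>h b (f b)\<close> has indicator zero, and both sides vanish.\<close>
  have split: "indicator ?Q (\<Sum>b\<in>?B. f b *\<^sub>R b) *\<^sub>R ?e (\<Sum>b\<in>?B. f b *\<^sub>R b) = (\<Prod>b\<in>?B. h b (f b))"
    for f
  proof (cases "\<forall>b\<in>?B. f b \<in> {0..2 * pi}")
    case True
    then have "(\<Prod>b\<in>?B. h b (f b)) = (\<Prod>b\<in>?B. exp (\<i> * complex_of_real ((int_vec k \<bullet> b) * f b)))"
      by (intro prod.cong) (auto simp: h_def)
    also have "\<dots> = ?e (\<Sum>b\<in>?B. f b *\<^sub>R b)"
      by (simp add: exp_sum[symmetric] inner_sum_right sum_distrib_left mult_ac)
    finally show ?thesis using True by (simp add: Q indicator_def)
  next
    case False
    then obtain b where "b \<in> ?B" "h b (f b) = 0"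
      by (auto simp: h_def indicator_def)
    then have "(\<Prod>b\<in>?B. h b (f b)) = 0"
      by (intro prod_zero) auto
    moreover have "indicator ?Q (\<Sum>b\<in>?B. f b *\<^sub>R b) = (0::real)"
      using False by (simp add: Q indicator_def)
    ultimately show ?thesis by (simp only: scaleR_zero_left)
  qed
  have "set_integrable lborel ?Q ?e"
    unfolding set_integrable_def
    by (intro borel_integrable_compact compact_cbox continuous_intros)
  then have "integral ?Q ?e = (LINT x:?Q|lborel. ?e x)"
    by (rule set_borel_integral_eq_integral(2)[symmetric])
  \<comment> \<open>By \<open>lborel_eq\<close>, Lebesgue measure is the image of the product
    measure under the map from coordinates to vectors, so the integral can be pulled back along that
    map.\<close>
  also have "\<dots> = (LINT f|(Pi\<^sub>M ?B (\<lambda>_. lborel)). (\<Prod>b\<in>?B. h b (f b)))"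
  proof -
    have "(\<lambda>f. \<Sum>b\<in>?B. f b *\<^sub>R b) \<in> measurable (Pi\<^sub>M ?B (\<lambda>_. lborel)) borel"
      by measurable
    moreover have "(\<lambda>x. indicator ?Q x *\<^sub>R ?e x) \<in> borel_measurable borel"
      by (intro borel_measurable_scaleR borel_measurable_indicator
          borel_measurable_continuous_onI continuous_intros) simp
    ultimately show ?thesis
      unfolding set_lebesgue_integral_def lborel_eq[where 'a = "real ^ 'm"]
      by (simp only: integral_distr split)
  qed
  also have "\<dots> = (\<Prod>b\<in>?B. integral\<^sup>L lborel (h b))"
    by (intro product_integral_prod h_integrable) auto
  also have "\<dots> = (\<Prod>b\<in>?B. if int_vec k \<bullet> b = 0 then 2 * pi else 0)"
    by (simp add: h_int cong: prod.cong)
  also have "\<dots> = (if k = 0 then (2 * pi) ^ CARD('m) else 0)"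
  proof (cases "k = 0")
    case True
    then have "int_vec k = 0" by (simp add: int_vec_def vec_eq_iff)
    with True show ?thesis by simp
  next
    case False
    then have "int_vec k \<noteq> 0" by (simp add: int_vec_def vec_eq_iff)
    then obtain b where "b \<in> ?B" "int_vec k \<bullet> b \<noteq> 0"
      using euclidean_all_zero_iff by blast
    then have "(\<Prod>b\<in>?B. if int_vec k \<bullet> b = 0 then 2 * pi else 0) = (0::real)"
      by (intro prod_zero) auto
    with False show ?thesis by simp
  qed
  finally show ?thesis .
qed

text \<open>The real form of a trigonometric polynomial: its values stay in the real space, and a
  directional derivative only changes \<open>a\<close> and \<open>b\<close>, with the same
  \<open>S\<close>.\<close>

definition trig_poly ::
    "(int ^ 'm) set \<Rightarrow> (int ^ 'm \<Rightarrow> 'b::real_normed_vector) \<Rightarrow> (int ^ 'm \<Rightarrow> 'b) \<Rightarrow> real ^ 'm \<Rightarrow> 'b" where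
  "trig_poly S a b x = (\<Sum>k\<in>S. cos (int_vec k \<bullet> x) *\<^sub>R a k + sin (int_vec k \<bullet> x) *\<^sub>R b k)"

text \<open>Frequencies and period shifts are both integral, so each phase changes by an integer
  multiple of 2 pi.\<close>

lemma torus_fun_trig_poly:
  fixes S :: "(int ^ 'm) set"
  shows "torus_fun (trig_poly S a b)"
proof -
  have "int_vec k \<bullet> (x + (2 * pi) *\<^sub>R int_vec l)
      = int_vec k \<bullet> x + 2 * pi * of_int (\<Sum>i\<in>UNIV. k $ i * l $ i)" for k l :: "int ^ 'm" and x
    by (simp only: inner_add_right inner_scaleR_right inner_int_vec)
  then show ?thesis
    by (simp only: torus_fun_def trig_poly_def cos_add sin_add cos_int_2pin sin_int_2pin
        mult_1_right mult_zero_right diff_zero add_0_right simp_thms)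
qed

lemma has_derivative_trig_poly:
  "(trig_poly S a b has_derivative
     (\<lambda>w. trig_poly S (\<lambda>k. (int_vec k \<bullet> w) *\<^sub>R b k) (\<lambda>k. - ((int_vec k \<bullet> w) *\<^sub>R a k)) x)) (at x)"
proof -
  have "((\<lambda>x. \<Sum>k\<in>S. cos (int_vec k \<bullet> x) *\<^sub>R a k + sin (int_vec k \<bullet> x) *\<^sub>R b k) has_derivative
     (\<lambda>w. \<Sum>k\<in>S. - (int_vec k \<bullet> w) *\<^sub>R sin (int_vec k \<bullet> x) *\<^sub>R a k
                + (int_vec k \<bullet> w) *\<^sub>R cos (int_vec k \<bullet> x) *\<^sub>R b k)) (at x)"
    by (auto intro!: derivative_eq_intros sum.cong)
  then show ?thesis
    unfolding trig_poly_def[abs_def] by (simp add: mult_ac add_ac)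
qed

lemma frechet_derivative_trig_poly:
  "frechet_derivative (trig_poly S a b) (at x) w
     = trig_poly S (\<lambda>k. (int_vec k \<bullet> w) *\<^sub>R b k) (\<lambda>k. - ((int_vec k \<bullet> w) *\<^sub>R a k)) x"
  by (rule fun_cong[OF frechet_derivative_at[OF has_derivative_trig_poly], symmetric])

lemma smooth_trig_poly: "smooth (trig_poly S a b)"
proof -
  have "C_diff n (trig_poly S a b)" for n
  \<comment> \<open>The coefficients are generalised because the derivative is a
    \<open>trig_poly\<close> with other coefficients.\<close>
  proof (induction n arbitrary: a b)
    case 0
    show ?case unfolding C_diff.simps trig_poly_def by (intro continuous_intros)
  next
    case (Suc n)
    have "trig_poly S a b differentiable (at x)" for x
      using has_derivative_trig_poly unfolding differentiable_def by blast
    then show ?case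
      using Suc by (simp add: frechet_derivative_trig_poly)
  qed
  then show ?thesis by (simp add: smooth_def)
qed

text \<open>Continuity gives the integrability needed to move the coordinate projection inside the
  vector-valued integral.\<close>

lemma fourier_coeff_nth:
  fixes f :: "real ^ 'm \<Rightarrow> real ^ 'm"
  assumes "continuous_on UNIV f"
  shows "fourier_coeff f k $ i = (1 / (2 * pi) ^ CARD('m)) *\<^sub>R
       integral (cbox 0 (\<chi> i. 2 * pi))
         (\<lambda>x. complex_of_real (f x $ i) * exp (- \<i> * complex_of_real (int_vec k \<bullet> x)))"
proof -
  let ?Q = "cbox 0 (\<chi> i. 2 * pi) :: (real ^ 'm) set"
  let ?F = "\<lambda>x. \<chi> i. complex_of_real (f x $ i) * exp (- \<i> * complex_of_real (int_vec k \<bullet> x))"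
  have "?F integrable_on ?Q"
    by (intro integrable_continuous continuous_on_vec_lambda continuous_intros
        continuous_on_subset[OF assms]) auto
  from integral_linear[OF this bounded_linear_vec_nth[of i]]
  show ?thesis by (simp add: fourier_coeff_def o_def)
qed

text \<open>As \<open>f\<close> is real, conjugating the integrand for \<open>k\<close> gives the
  integrand for \<open>- k\<close>.\<close>

lemma fourier_coeff_uminus:
  assumes "continuous_on UNIV f"
  shows "fourier_coeff f (- k) $ i = cnj (fourier_coeff f k $ i)"
  by (simp add: fourier_coeff_nth[OF assms] integral_cnj exp_cnj int_vec_uminus)

lemma fourier_coeff_diff:
  fixes f g :: "real ^ 'm \<Rightarrow> real ^ 'm"
  assumes "continuous_on UNIV f" "continuous_on UNIV g"
  shows "fourier_coeff (\<lambda>x. f x - g x) k = fourier_coeff f k - fourier_coeff g k"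
proof -
  have "continuous_on UNIV (\<lambda>x. f x - g x)"
    using assms by (intro continuous_intros)
  moreover have "(\<lambda>x. complex_of_real (h x $ i) * exp (- \<i> * complex_of_real (int_vec k \<bullet> x)))
      integrable_on cbox a b" if "continuous_on UNIV h" for h :: "real ^ 'm \<Rightarrow> real ^ 'm" and i a b
    by (intro integrable_continuous continuous_intros continuous_on_subset[OF that]) auto
  ultimately show ?thesis
    using assms by (simp add: vec_eq_iff fourier_coeff_nth left_diff_distrib integral_diff
        scaleR_diff_right)
qed

text \<open>The polynomial is the real part of the sum of \<open>c k\<close> times the exponential
  of frequency \<open>k\<close>, that is, half of this sum plus its conjugate. One half of
  \<open>c l\<close> comes from \<open>k = l\<close>, the other from the conjugate term at
  \<open>k = - l\<close>, by the symmetry of \<open>c\<close>.\<close>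

lemma fourier_coeff_trig_poly:
  fixes c :: "int ^ 'm \<Rightarrow> complex ^ 'm"
  assumes "finite S" "l \<in> S" "- l \<in> S" and cnj: "\<And>i. c (- l) $ i = cnj (c l $ i)"
  shows "fourier_coeff (trig_poly S (\<lambda>k. \<chi> i. Re (c k $ i)) (\<lambda>k. \<chi> i. - Im (c k $ i))) l = c l"
proof (subst vec_eq_iff, intro allI)
  fix i
  let ?Q = "cbox 0 (\<chi> i. 2 * pi) :: (real ^ 'm) set"
  let ?e = "\<lambda>k x. exp (\<i> * complex_of_real (int_vec k \<bullet> x))"
  let ?p = "trig_poly S (\<lambda>k. \<chi> i. Re (c k $ i)) (\<lambda>k. \<chi> i. - Im (c k $ i))"
  have cont: "continuous_on UNIV ?p"
    using smooth_trig_poly unfolding smooth_def by (metis C_diff.simps(1))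
  have Re_eq: "complex_of_real (cos t * Re z - sin t * Im z)
      = (z * exp (\<i> * of_real t) + cnj z * exp (- \<i> * of_real t)) / 2" for t z
    by (simp add: complex_eq_iff Re_exp Im_exp)
  \<comment> \<open>The factor with frequency \<open>- l\<close> shifts the frequencies to
    \<open>k - l\<close> and \<open>- k - l\<close>, so that orthogonality singles out
    \<open>k = l\<close> and \<open>k = - l\<close>.\<close>
  have expand: "complex_of_real (?p x $ i) * exp (- \<i> * complex_of_real (int_vec l \<bullet> x))
     = (\<Sum>k\<in>S. c k $ i / 2 * ?e (k - l) x + cnj (c k $ i) / 2 * ?e (- k - l) x)" for x
  proof -
    have "?p x $ i = (\<Sum>k\<in>S. cos (int_vec k \<bullet> x) * Re (c k $ i) - sin (int_vec k \<bullet> x) * Im (c k $ i))"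
      by (simp add: trig_poly_def)
    then have "complex_of_real (?p x $ i) = (\<Sum>k\<in>S. (c k $ i * ?e k x + cnj (c k $ i) * ?e (- k) x) / 2)"
      by (simp only: of_real_sum Re_eq) (simp add: int_vec_uminus)
    then show ?thesis
      by (simp add: int_vec_diff int_vec_uminus sum_distrib_right inner_diff_left ring_distribs add_divide_distrib
          mult.assoc flip: exp_add)
  qed
  have int: "?e k integrable_on ?Q" for k :: "int ^ 'm"
    by (intro integrable_continuous continuous_intros)
  have "integral ?Q (\<lambda>x. complex_of_real (?p x $ i) * exp (- \<i> * complex_of_real (int_vec l \<bullet> x)))
      = (\<Sum>k\<in>S. c k $ i / 2 * integral ?Q (?e (k - l)) + cnj (c k $ i) / 2 * integral ?Q (?e (- k - l)))"
    unfolding expand using \<open>finite S\<close>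
    by (intro integral_unique has_integral_sum has_integral_add has_integral_mult_right
        integrable_integral int)
  \<comment> \<open>Two separate conditionals also cover \<open>l = 0\<close>, where both halves
    come from the same \<open>k\<close>.\<close>
  also have "\<dots> = (\<Sum>k\<in>S. (if k = l then c l $ i / 2 * (2 * pi) ^ CARD('m) else 0)
      + (if k = - l then cnj (c (- l) $ i) / 2 * (2 * pi) ^ CARD('m) else 0))"
    unfolding integral_exp_int_vec
    by (intro sum.cong refl arg_cong2[of _ _ _ _ "(+)"]) (auto simp: algebra_simps add_eq_0_iff)
  also have "\<dots> = c l $ i * (2 * pi) ^ CARD('m)"
    using assms by (simp add: sum.distrib)
  finally show "fourier_coeff ?p l $ i = c l $ i"
    by (simp add: fourier_coeff_nth[OF cont] scaleR_conv_of_real)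
qed

theorem corollary4p6:
  fixes \<omega> :: "real ^ 'm" and U :: "real ^ 'm \<Rightarrow> real ^ 'm" and K :: nat
  assumes "torus_fun U" and "smooth U"
  shows "\<exists>g f :: real ^ 'm \<Rightarrow> real ^ 'm.
           torus_fun g \<and> smooth g \<and> torus_fun f \<and>
           (\<forall>\<phi>. dir_deriv \<omega> g \<phi> + f \<phi> = U \<phi>) \<and>
           normal_form_to_order \<omega> K f"
proof -
  define S :: "(int ^ 'm) set" where "S = {k. \<omega> \<bullet> int_vec k \<noteq> 0 \<and> norm (int_vec k) \<le> real K}"
  define c where "c = fourier_coeff U"
  define p where "p = trig_poly S (\<lambda>k. \<chi> i. Re (c k $ i)) (\<lambda>k. \<chi> i. - Im (c k $ i))"
  \<comment> \<open>With d the inner product of \<open>\<omega>\<close> and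
    \<open>int_vec k\<close>, dividing a coefficient z by \<i> d gives (Im z - \<i> Re z) / d. Its
    real part and its negated imaginary part are the coefficients of cosine and sine here.\<close>
  define g where "g = trig_poly S (\<lambda>k. (1 / (\<omega> \<bullet> int_vec k)) *\<^sub>R (\<chi> i. Im (c k $ i)))
                                  (\<lambda>k. (1 / (\<omega> \<bullet> int_vec k)) *\<^sub>R (\<chi> i. Re (c k $ i)))"
  have "finite S"
    using finite_int_vec_ball by (rule rev_finite_subset) (auto simp: S_def)
  have U: "continuous_on UNIV U"
    using \<open>smooth U\<close> unfolding smooth_def by (metis C_diff.simps(1))
  have p: "continuous_on UNIV p"
    using smooth_trig_poly unfolding smooth_def p_def by (metis C_diff.simps(1))
  \<comment> \<open>Differentiation brings out the inner product of \<open>int_vec k\<close> and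
    \<open>\<omega>\<close>, which cancels the divisor, nonzero on \<open>S\<close>. Hence
    \<open>U - p\<close> is the function \<open>f\<close> that solves the equation.\<close>
  have "dir_deriv \<omega> g \<phi> = p \<phi>" for \<phi>
    unfolding dir_deriv_def g_def p_def frechet_derivative_trig_poly
    unfolding trig_poly_def
    by (intro sum.cong refl) (auto simp: S_def inner_commute vec_eq_iff)
  moreover have "torus_fun (\<lambda>x. U x - p x)"
    using \<open>torus_fun U\<close> torus_fun_trig_poly[of S] by (simp add: torus_fun_def p_def)
  moreover have "normal_form_to_order \<omega> K (\<lambda>x. U x - p x)"
    unfolding normal_form_to_order_def
  proof (intro allI impI)
    fix k assume k: "\<omega> \<bullet> int_vec k \<noteq> 0 \<and> norm (int_vec k) \<le> real K"
    \<comment> \<open>Both conditions defining \<open>S\<close> are invariant under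
      \<open>k \<mapsto> - k\<close>, so \<open>- k\<close> lies in \<open>S\<close> too; the
      conjugate symmetry of \<open>c\<close> holds because \<open>U\<close> is real.\<close>
    then have "fourier_coeff p k = c k"
      unfolding p_def using \<open>finite S\<close>
      by (intro fourier_coeff_trig_poly) (auto simp: S_def c_def int_vec_uminus fourier_coeff_uminus[OF U])
    then show "fourier_coeff (\<lambda>x. U x - p x) k = 0"
      by (simp add: fourier_coeff_diff[OF U p] c_def)
  qed
  moreover have "torus_fun g" "smooth g"
    unfolding g_def by (rule torus_fun_trig_poly, rule smooth_trig_poly)
  ultimately show ?thesis
    by (intro exI[of _ g] exI[of _ "\<lambda>x. U x - p x"]) simp
qed

end
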